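(* Let $A \in \mathbb{R}^{n \times d}$ have rank $d$, with rows $a_1^\top,\dots,a_n^\top$. Define $w_1 \in \mathbb{R}^n$ by $w_{1,i} = d/n$ for all $i$, and for $k \geq 1$, \[ w_{k+1,i} = w_{k,i} \cdot a_i^\top (A^\top \mathrm{diag}(w_k) A)^{-1} a_i \quad (i \in [n]). \] For a positive integer $T$, let $u := \frac{1}{T}\sum_{k=1}^T w_k$ and $\sigma_i(u) := a_i^\top (A^\top \mathrm{diag}(u) A)^{-1} a_i$. Then for every $\epsilon \in (0,1)$, for a suitable choice $T = O(\epsilon^{-1} \log(n/d))$, we have \[ \sigma_i(u) \leq 1+\epsilon \quad \text{for all } i \in [n], \qquad \text{and} \qquad \sum_{i=1}^n u_i = d. \]
   Context: $\mathrm{diag}(v)$ denotes the diagonal matrix with diagonal $v$. The vector $u$ is the output weight vector of the paper's fixed-point iteration for approximating the John ellipsoid of $\{x : -\mathbf{1}_n \le Ax \le \mathbf{1}_n\}$. *)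

theory Defs
  imports
    Complex_Main
    "Jordan_Normal_Form.DL_Rank"
    "Jordan_Normal_Form.Gauss_Jordan_Elimination"
begin

text \<open>
  Dimensions are carried by \<^const>\<open>carrier_mat\<close> rather than by types, so that one constant can
  be uniform in \<open>n\<close> and \<open>d\<close>. Indices run over \<open>{..<n}\<close>.
\<close>

definition weighted_gram :: "real mat \<Rightarrow> real vec \<Rightarrow> real mat" where
  "weighted_gram A v =
     transpose_mat A * mat_diag (dim_row A) (\<lambda>i. v $ i) * A"

text \<open>
  \<^const>\<open>mat_inverse\<close> is \<^const>\<open>None\<close> exactly on singular matrices. Below, \<open>\<sigma>\<close> is only of interest
  when the weighted Gram matrix is invertible, as it is for full column rank and weights positive on nonzero rows;
  otherwise its value is unspecified.
\<close>
definition \<sigma> :: "real mat \<Rightarrow> real vec \<Rightarrow> nat \<Rightarrow> real" where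
  "\<sigma> A v i = row A i \<bullet> (the (mat_inverse (weighted_gram A v)) *\<^sub>v row A i)"

text \<open>The iteration is indexed from 0: \<open>weights A k\<close> is \<open>w\<^sub>k\<^sub>+\<^sub>1\<close>.\<close>
primrec weights :: "real mat \<Rightarrow> nat \<Rightarrow> real vec" where
  "weights A 0 = vec (dim_row A) (\<lambda>_. real (dim_col A) / real (dim_row A))"
| "weights A (Suc k) =
     vec (dim_row A) (\<lambda>i. weights A k $ i * \<sigma> A (weights A k) i)"

definition avg_weights :: "real mat \<Rightarrow> nat \<Rightarrow> real vec" where
  "avg_weights A T =
     vec (dim_row A) (\<lambda>i. (1 / real T) * (\<Sum>k<T. weights A k $ i))"

text \<open>
  \<open>T \<in> O(\<epsilon>\<^sup>-\<^sup>1 log (n/d))\<close> for a positive integer \<open>T\<close>, with hidden constant \<open>C\<close>. The maximum with 1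
  is only there because \<open>\<epsilon>\<^sup>-\<^sup>1 log (n/d)\<close> may be arbitrarily small, and is 0 for \<open>n = d\<close>, whereas
  \<open>T \<ge> 1\<close>.
\<close>
definition iteration_bound :: "real \<Rightarrow> nat \<Rightarrow> nat \<Rightarrow> real \<Rightarrow> real" where
  "iteration_bound C n d \<epsilon> = max 1 (C * (1 / \<epsilon>) * ln (real n / real d))"

end

theory Submission
  imports Defs "HOL-Analysis.Convex"
begin

text \<open>
  For \<open>a\<^sub>i \<noteq> 0\<close>, duality gives \<open>1 / \<sigma> w i = min {x\<^sup>T A\<^sup>T diag(w) A x | a\<^sub>i\<^sup>T x = 1}\<close>, a minimum of functions linear in \<open>w\<close>,
  so \<open>1 / \<sigma>\<close> is concave in the weights and \<open>1 / \<sigma> u i\<close> is at least the mean over \<open>k\<close> of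
  \<open>1 / \<sigma> w\<^sub>k i = w\<^sub>k\<^sub>,\<^sub>i / w\<^sub>k\<^sub>+\<^sub>1\<^sub>,\<^sub>i\<close>. The logarithms of these ratios telescope, and their sum is at least
  \<open>- ln (n / d)\<close> because weights never exceed 1 after the first step; AM-GM then bounds the mean.
\<close>

section \<open>Column rank and the bilinear form of the weighted Gram matrix\<close>

lemma row_zero_scalar_prod:
  fixes x :: "'a::semiring_0 vec"
  assumes "dim_vec x = d" "i < n" "row A i = 0\<^sub>v d"
  shows "row A i \<bullet> x = 0"
  using assms by (simp add: scalar_prod_def)

text \<open>Linear independence concerns the set of columns and does not notice a repeated one. Rank
  \<open>nc\<close> first forces \<open>nc\<close> different columns; once they are distinct, a
  nonzero kernel vector is a linear dependence among them.\<close>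

lemma (in vec_space) full_rank_imp_trivial_kernel:
  assumes A: "A \<in> carrier_mat n nc" and rank: "rank A = nc"
    and v: "v \<in> carrier_vec nc" "A *\<^sub>v v = 0\<^sub>v n"
  shows "v = 0\<^sub>v nc"
proof -
  obtain S where S: "maximal S (\<lambda>T. T \<subseteq> set (cols A) \<and> lin_indpt T)"
    using maximal_exists[of "(\<lambda>T. T \<subseteq> set (cols A) \<and> lin_indpt T)" "card (set (cols A))" "{}"]
    by (meson List.finite_set card_mono empty_iff empty_subsetI finite_lin_indpt2 rev_finite_subset)
  have "nc = card S"
    using rank_card_indpt[OF A S] rank by simp
  also have "\<dots> \<le> card (set (cols A))"
    using S by (simp add: card_mono maximal_def)
  finally have "card (set (cols A)) = length (cols A)"
    using A card_length[of "cols A"] by simp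
  then have dist: "distinct (cols A)"
    by (rule card_distinct)
  show ?thesis
    using lin_depI[OF A v(1) _ v(2) dist] full_rank_lin_indpt[OF A rank dist] by blast
qed

lemma weighted_gram_carrier:
  "A \<in> carrier_mat n d \<Longrightarrow> weighted_gram A v \<in> carrier_mat d d"
  unfolding weighted_gram_def by auto

text \<open>Moving \<open>transpose_mat A\<close> across the inner product leaves a weighted sum
  over rows, so that later arguments can work with sums that are linear in the weights.\<close>

lemma weighted_gram_form:
  assumes A: "A \<in> carrier_mat n d" and x: "x \<in> carrier_vec d" and y: "y \<in> carrier_vec d"
  shows "(weighted_gram A v *\<^sub>v y) \<bullet> x = (\<Sum>i<n. v $ i * (row A i \<bullet> x) * (row A i \<bullet> y))"
proof -
  define D where "D = mat_diag n (\<lambda>i. v $ i)"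
  have D: "D \<in> carrier_mat n n" and At: "transpose_mat A \<in> carrier_mat d n"
    using A by (auto simp: D_def)
  have Ay: "A *\<^sub>v y \<in> carrier_vec n"
    using A y by auto
  have "weighted_gram A v *\<^sub>v y = transpose_mat A *\<^sub>v (D *\<^sub>v (A *\<^sub>v y))"
    using A assoc_mult_mat_vec[OF mult_carrier_mat[OF At D] A y] assoc_mult_mat_vec[OF At D Ay]
    unfolding weighted_gram_def D_def by simp
  then have "(weighted_gram A v *\<^sub>v y) \<bullet> x = (D *\<^sub>v (A *\<^sub>v y)) \<bullet> (A *\<^sub>v x)"
    using transpose_vec_mult_scalar[OF A x mult_mat_vec_carrier[OF D Ay]] by simp
  also have "\<dots> = (\<Sum>i<n. (row D i \<bullet> (A *\<^sub>v y)) * (row A i \<bullet> x))"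
    using A D unfolding scalar_prod_def[of _ "A *\<^sub>v x"] by (intro sum.cong) auto
  also have "\<dots> = (\<Sum>i<n. v $ i * (row A i \<bullet> x) * (row A i \<bullet> y))"
  proof (intro sum.cong refl)
    fix i assume "i \<in> {..<n}"
    then have "row D i \<bullet> (A *\<^sub>v y) = (\<Sum>j<n. if i = j then v $ j * (row A j \<bullet> y) else 0)"
      using A unfolding scalar_prod_def[of "row D i"]
      by (intro sum.cong) (auto simp: D_def mat_diag_def)
    then show "(row D i \<bullet> (A *\<^sub>v y)) * (row A i \<bullet> x) = v $ i * (row A i \<bullet> x) * (row A i \<bullet> y)"
      using \<open>i \<in> {..<n}\<close> by simp
  qed
  finally show ?thesis .
qed

lemma weighted_gram_index:
  assumes A: "A \<in> carrier_mat n d" and "p < d" "q < d"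
  shows "weighted_gram A v $$ (p, q) = (\<Sum>i<n. v $ i * A $$ (i, p) * A $$ (i, q))"
proof -
  have "weighted_gram A v $$ (p, q) = (weighted_gram A v *\<^sub>v unit_vec d q) \<bullet> unit_vec d p"
    using assms weighted_gram_carrier[OF A, of v] by auto
  also have "\<dots> = (\<Sum>i<n. v $ i * A $$ (i, p) * A $$ (i, q))"
    using assms by (subst weighted_gram_form[OF A]) auto
  finally show ?thesis .
qed

lemma weighted_Cauchy_Schwarz:
  fixes f g w :: "nat \<Rightarrow> real"
  assumes "\<And>j. j < n \<Longrightarrow> 0 \<le> w j"
  shows "(\<Sum>j<n. w j * f j * g j)\<^sup>2 \<le> (\<Sum>j<n. w j * f j * f j) * (\<Sum>j<n. w j * g j * g j)"
proof -
  have "(\<Sum>j<n. w j * f j * g j) = (\<Sum>j<n. (sqrt (w j) * f j) * (sqrt (w j) * g j))"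
    "(\<Sum>j<n. w j * f j * f j) = (\<Sum>j<n. (sqrt (w j) * f j)\<^sup>2)"
    "(\<Sum>j<n. w j * g j * g j) = (\<Sum>j<n. (sqrt (w j) * g j)\<^sup>2)"
    using assms by (auto intro!: sum.cong simp: power2_eq_square algebra_simps)
  then show ?thesis
    using Cauchy_Schwarz_ineq_sum[of "\<lambda>j. sqrt (w j) * f j" "\<lambda>j. sqrt (w j) * g j" "{..<n}"] by simp
qed

section \<open>Leverage scores under admissible weights\<close>

locale full_column_rank =
  fixes A :: "real mat" and n d :: nat
  assumes A: "A \<in> carrier_mat n d"
    and trivial_kernel: "x \<in> carrier_vec d \<Longrightarrow> A *\<^sub>v x = 0\<^sub>v n \<Longrightarrow> x = 0\<^sub>v d"
begin

text \<open>A zero row has \<sigma> equal to 0, so its weight drops to 0 after one step. Strict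
  positivity is therefore asked only on nonzero rows; this is preserved by the iteration and still
  makes the Gram matrix invertible.\<close>

definition admissible :: "real vec \<Rightarrow> bool" where
  "admissible w \<longleftrightarrow> (\<forall>i<n. 0 \<le> w $ i \<and> (row A i \<noteq> 0\<^sub>v d \<longrightarrow> 0 < w $ i))"

text \<open>At a kernel vector \<open>x\<close> the quadratic form is a vanishing sum of nonnegative
  terms. Hence every row is orthogonal to \<open>x\<close>, because its weight is positive or the
  row itself is zero, and the trivial kernel of \<open>A\<close> gives \<open>x = 0\<close>.\<close>

lemma weighted_gram_inverse:
  assumes w: "admissible w"
  obtains N where "mat_inverse (weighted_gram A w) = Some N" "N \<in> carrier_mat d d"
    "weighted_gram A w * N = 1\<^sub>m d" "N * weighted_gram A w = 1\<^sub>m d"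
proof -
  let ?M = "weighted_gram A w"
  note M = weighted_gram_carrier[OF A, of w]
  have "det ?M \<noteq> 0"
  proof
    assume "det ?M = 0"
    then obtain x where x: "x \<in> carrier_vec d" "x \<noteq> 0\<^sub>v d" "?M *\<^sub>v x = 0\<^sub>v d"
      using det_0_iff_vec_prod_zero_field[OF M] by auto
    have "(\<Sum>i<n. w $ i * (row A i \<bullet> x) * (row A i \<bullet> x)) = 0"
      using weighted_gram_form[OF A x(1) x(1), of w] x(1,3) by simp
    moreover have "0 \<le> w $ i * (row A i \<bullet> x) * (row A i \<bullet> x)" if "i < n" for i
      using w that by (simp add: admissible_def mult.assoc)
    ultimately have zero: "w $ i * (row A i \<bullet> x) * (row A i \<bullet> x) = 0" if "i < n" for i
      using that by (subst (asm) sum_nonneg_eq_0_iff) auto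
    have "row A i \<bullet> x = 0" if "i < n" for i
      using zero[OF that] w that x(1) row_zero_scalar_prod[of x d i n A]
      by (cases "row A i = 0\<^sub>v d") (auto simp: admissible_def)
    then have "A *\<^sub>v x = 0\<^sub>v n"
      using A by (intro eq_vecI) auto
    with trivial_kernel x show False by blast
  qed
  then have "mat_inverse ?M \<noteq> None"
    using mat_inverse(1)[OF M, of "()"] det_non_zero_imp_unit[OF M, of "()"] by blast
  then show thesis
    using mat_inverse(2)[OF M] that by blast
qed

text \<open>For admissible \<open>w\<close>, the Riesz representer of the functional given by row
  \<open>i\<close>, with respect to the inner product of the weighted Gram matrix. For a nonzero
  row, dividing it by \<sigma> gives the minimiser of the dual problem.\<close>

definition representer :: "real vec \<Rightarrow> nat \<Rightarrow> real vec" where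
  "representer w i = the (mat_inverse (weighted_gram A w)) *\<^sub>v row A i"

text \<open>The third claim is the reproducing property. Taking \<open>x\<close> to be the
  representer itself writes \<sigma> as the quadratic form at the representer, which is how \<sigma>
  is estimated below.\<close>

lemma \<sigma>_representer:
  assumes w: "admissible w" and i: "i < n"
  shows "representer w i \<in> carrier_vec d" "\<sigma> A w i = row A i \<bullet> representer w i"
    "x \<in> carrier_vec d \<Longrightarrow>
      row A i \<bullet> x = (\<Sum>j<n. w $ j * (row A j \<bullet> x) * (row A j \<bullet> representer w i))"
proof -
  obtain N where N: "mat_inverse (weighted_gram A w) = Some N" "N \<in> carrier_mat d d"
    "weighted_gram A w * N = 1\<^sub>m d"
    by (rule weighted_gram_inverse[OF w])
  note M = weighted_gram_carrier[OF A, of w]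
  have a: "row A i \<in> carrier_vec d" using A i by auto
  show z: "representer w i \<in> carrier_vec d"
    unfolding representer_def using N a by auto
  show "\<sigma> A w i = row A i \<bullet> representer w i"
    by (simp add: \<sigma>_def representer_def)
  have "weighted_gram A w *\<^sub>v representer w i = row A i"
    using assoc_mult_mat_vec[OF M N(2) a] N(1,3) a by (simp add: representer_def)
  then show "row A i \<bullet> x = (\<Sum>j<n. w $ j * (row A j \<bullet> x) * (row A j \<bullet> representer w i))"
    if "x \<in> carrier_vec d"
    using weighted_gram_form[OF A that z, of w] by simp
qed

lemma \<sigma>_zero_row:
  assumes "admissible w" "i < n" "row A i = 0\<^sub>v d"
  shows "\<sigma> A w i = 0"
  using \<sigma>_representer(1,2)[OF assms(1,2)] row_zero_scalar_prod[OF _ assms(2,3)] by simp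

text \<open>The inequality half of the duality \<open>1 / \<sigma> w i = min {x\<^sup>T A\<^sup>T diag(w) A x | a\<^sub>i\<^sup>T x = 1}\<close>.\<close>
lemma \<sigma>_dual_bound:
  assumes w: "admissible w" and i: "i < n" and x: "x \<in> carrier_vec d"
  shows "(row A i \<bullet> x)\<^sup>2 \<le> \<sigma> A w i * (\<Sum>j<n. w $ j * (row A j \<bullet> x) * (row A j \<bullet> x))"
proof -
  define z where "z = representer w i"
  note z = \<sigma>_representer[OF w i, folded z_def]
  have "(row A i \<bullet> x)\<^sup>2 = (\<Sum>j<n. w $ j * (row A j \<bullet> z) * (row A j \<bullet> x))\<^sup>2"
    using z(3)[OF x] by (simp add: ac_simps)
  also have "\<dots> \<le> (\<Sum>j<n. w $ j * (row A j \<bullet> z) * (row A j \<bullet> z))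
      * (\<Sum>j<n. w $ j * (row A j \<bullet> x) * (row A j \<bullet> x))"
    using w by (intro weighted_Cauchy_Schwarz) (auto simp: admissible_def)
  finally show ?thesis
    using z(2) z(3)[OF z(1)] by simp
qed

lemma \<sigma>_nonneg:
  assumes w: "admissible w" and i: "i < n"
  shows "0 \<le> \<sigma> A w i"
proof -
  define z where "z = representer w i"
  note z = \<sigma>_representer[OF w i, folded z_def]
  show ?thesis
    using w unfolding z(2) z(3)[OF z(1)]
    by (intro sum_nonneg) (auto simp: admissible_def mult.assoc)
qed

text \<open>Testing the dual bound with \<open>x = row A i\<close> makes its left side positive, so
  \<sigma> cannot vanish.\<close>

lemma \<sigma>_pos:
  assumes w: "admissible w" and i: "i < n" and row: "row A i \<noteq> 0\<^sub>v d"
  shows "0 < \<sigma> A w i"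
proof -
  have a: "row A i \<in> carrier_vec d" using A i by auto
  have "row A i \<bullet> row A i \<noteq> 0"
    using conjugate_square_eq_0_vec[OF a] row by simp
  then have "0 < (row A i \<bullet> row A i)\<^sup>2" by simp
  with \<sigma>_dual_bound[OF w i a] have "\<sigma> A w i \<noteq> 0" by auto
  with \<sigma>_nonneg[OF w i] show ?thesis by simp
qed

text \<open>Keeping only the term \<open>j = i\<close> of the quadratic form at the representer
  gives \<open>w $ i * (\<sigma> A w i)\<^sup>2 \<le> \<sigma> A w i\<close>; then \<sigma> cancels.
  The product on the left is the next weight.\<close>

lemma weight_\<sigma>_le_1:
  assumes w: "admissible w" and i: "i < n"
  shows "w $ i * \<sigma> A w i \<le> 1"
proof (cases "\<sigma> A w i = 0")
  case False
  define z where "z = representer w i"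
  note z = \<sigma>_representer[OF w i, folded z_def]
  have "w $ i * (row A i \<bullet> z) * (row A i \<bullet> z) \<le> (\<Sum>j<n. w $ j * (row A j \<bullet> z) * (row A j \<bullet> z))"
    using w i by (intro member_le_sum) (auto simp: admissible_def mult.assoc)
  then have "w $ i * \<sigma> A w i * \<sigma> A w i \<le> 1 * \<sigma> A w i"
    using z(2) z(3)[OF z(1)] by simp
  with False \<sigma>_nonneg[OF w i] show ?thesis
    by (auto intro: mult_right_le_imp_le[of _ "\<sigma> A w i"])
qed simp

text \<open>The sum is the trace of \<open>(A\<^sup>T diag(w) A)\<^sup>-\<^sup>1 (A\<^sup>T diag(w) A)\<close>.\<close>
lemma sum_weight_\<sigma>:
  assumes w: "admissible w"
  shows "(\<Sum>i<n. w $ i * \<sigma> A w i) = real d"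
proof -
  obtain N where N: "mat_inverse (weighted_gram A w) = Some N" "N \<in> carrier_mat d d"
    "N * weighted_gram A w = 1\<^sub>m d"
    by (rule weighted_gram_inverse[OF w])
  note M = weighted_gram_carrier[OF A, of w]
  have \<sigma>: "\<sigma> A w i = (\<Sum>p<d. \<Sum>q<d. N $$ (p, q) * (A $$ (i, p) * A $$ (i, q)))" if "i < n" for i
    using that A N(2)
    by (auto simp: \<sigma>_def N(1) scalar_prod_def sum_distrib_left atLeast0LessThan ac_simps
        intro!: sum.cong)
  have "(\<Sum>i<n. w $ i * \<sigma> A w i)
      = (\<Sum>i<n. \<Sum>p<d. \<Sum>q<d. N $$ (p, q) * (w $ i * A $$ (i, q) * A $$ (i, p)))"
    by (auto simp: \<sigma> sum_distrib_left ac_simps intro!: sum.cong)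
  also have "\<dots> = (\<Sum>p<d. \<Sum>i<n. \<Sum>q<d. N $$ (p, q) * (w $ i * A $$ (i, q) * A $$ (i, p)))"
    by (rule sum.swap)
  also have "\<dots> = (\<Sum>p<d. \<Sum>q<d. \<Sum>i<n. N $$ (p, q) * (w $ i * A $$ (i, q) * A $$ (i, p)))"
    by (intro sum.cong refl sum.swap)
  also have "\<dots> = (\<Sum>p<d. \<Sum>q<d. N $$ (p, q) * weighted_gram A w $$ (q, p))"
    by (auto simp: weighted_gram_index[OF A] sum_distrib_left intro!: sum.cong)
  also have "\<dots> = (\<Sum>p<d. (N * weighted_gram A w) $$ (p, p))"
    using N(2) M by (auto simp: scalar_prod_def atLeast0LessThan intro!: sum.cong)
  also have "\<dots> = real d"
    by (simp add: N(3))
  finally show ?thesis .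
qed

section \<open>The iterates and their average\<close>

lemma admissible_weights:
  assumes "0 < d"
  shows "admissible (weights A k)"
proof (induction k)
  case 0
  show ?case using A assms by (auto simp: admissible_def)
next
  case (Suc k)
  then have "0 \<le> \<sigma> A (weights A k) i" "row A i \<noteq> 0\<^sub>v d \<Longrightarrow> 0 < \<sigma> A (weights A k) i" if "i < n" for i
    using \<sigma>_nonneg \<sigma>_pos that by auto
  then show ?case using Suc A by (auto simp: admissible_def)
qed

lemma sum_weights:
  assumes "0 < d"
  shows "(\<Sum>i<n. weights A k $ i) = real d"
proof (cases k)
  case 0
  \<comment> \<open>The initial sum \<open>n * (d / n)\<close> equals \<open>d\<close> only for
    nonzero \<open>n\<close>, as division by zero yields 0. Without rows every vector would lie in
    the kernel.\<close>
  have "n \<noteq> 0"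
  proof
    assume "n = 0"
    with A have "A *\<^sub>v unit_vec d 0 = 0\<^sub>v n" by (intro eq_vecI) auto
    then have "unit_vec d 0 $ 0 = (0\<^sub>v d $ 0 :: real)"
      using trivial_kernel[of "unit_vec d 0"] by simp
    with \<open>0 < d\<close> show False by simp
  qed
  with 0 A show ?thesis by simp
next
  case (Suc k')
  with A show ?thesis
    using sum_weight_\<sigma>[OF admissible_weights[OF assms, of k']] by simp
qed

lemma avg_weights_index:
  "i < n \<Longrightarrow> avg_weights A T $ i = (1 / real T) * (\<Sum>k<T. weights A k $ i)"
  using A by (simp add: avg_weights_def)

lemma sum_avg_weights:
  assumes "0 < d" "0 < T"
  shows "(\<Sum>i<n. avg_weights A T $ i) = real d"
proof -
  have "(\<Sum>i<n. avg_weights A T $ i) = (1 / real T) * (\<Sum>i<n. \<Sum>k<T. weights A k $ i)"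
    by (simp add: avg_weights_index sum_distrib_left)
  also have "(\<Sum>i<n. \<Sum>k<T. weights A k $ i) = real T * real d"
    by (subst sum.swap) (simp add: sum_weights[OF assms(1)])
  finally show ?thesis using assms by simp
qed

lemma admissible_avg_weights:
  assumes "0 < d" "0 < T"
  shows "admissible (avg_weights A T)"
proof -
  have "0 \<le> (\<Sum>k<T. weights A k $ i)" if "i < n" for i
    using admissible_weights[OF assms(1)] that by (intro sum_nonneg) (auto simp: admissible_def)
  moreover have "0 < (\<Sum>k<T. weights A k $ i)" if "i < n" "row A i \<noteq> 0\<^sub>v d" for i
    using admissible_weights[OF assms(1)] that assms(2) by (intro sum_pos) (auto simp: admissible_def)
  ultimately show ?thesis
    using assms(2) by (simp add: admissible_def avg_weights_index)
qed

text \<open>Concavity of \<open>1 / \<sigma>\<close>: the minimiser in the dual problem for the averaged weights is a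
  feasible point for every iterate.\<close>
lemma \<sigma>_avg_weights_harmonic:
  assumes "0 < d" "0 < T" and i: "i < n" and row: "row A i \<noteq> 0\<^sub>v d"
  shows "\<sigma> A (avg_weights A T) i * (\<Sum>k<T. 1 / \<sigma> A (weights A k) i) \<le> real T"
proof -
  let ?u = "avg_weights A T"
  let ?Q = "\<lambda>w x. \<Sum>j<n. w $ j * (row A j \<bullet> x) * (row A j \<bullet> x)"
  note adm = admissible_weights[OF assms(1)]
  have u: "admissible ?u" using admissible_avg_weights assms by blast
  define z where "z = representer ?u i"
  note z = \<sigma>_representer[OF u i, folded z_def]
  let ?s = "\<sigma> A ?u i"
  have s: "0 < ?s" using \<sigma>_pos[OF u i row] .
  have "?s * (?s * (\<Sum>k<T. 1 / \<sigma> A (weights A k) i)) = (\<Sum>k<T. ?s\<^sup>2 / \<sigma> A (weights A k) i)"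
    by (simp add: sum_distrib_left power2_eq_square mult.assoc)
  also have "\<dots> \<le> (\<Sum>k<T. ?Q (weights A k) z)"
    using \<sigma>_dual_bound[OF adm i z(1)] \<sigma>_pos[OF adm i row] z(2)
    by (intro sum_mono) (simp add: pos_divide_le_eq mult.commute)
  also have "\<dots> = (\<Sum>j<n. \<Sum>k<T. weights A k $ j * (row A j \<bullet> z) * (row A j \<bullet> z))"
    by (rule sum.swap)
  also have "\<dots> = (\<Sum>j<n. real T * (?u $ j * (row A j \<bullet> z) * (row A j \<bullet> z)))"
    using assms(2) by (intro sum.cong) (auto simp: avg_weights_index sum_distrib_right)
  also have "\<dots> = ?s * real T"
    using z(2) z(3)[OF z(1)] by (simp add: sum_distrib_left[symmetric])
  finally show ?thesis using s by simp
qed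

lemma sum_ln_\<sigma>_weights:
  assumes "0 < d" "0 < T" and i: "i < n" and row: "row A i \<noteq> 0\<^sub>v d"
  shows "(\<Sum>k<T. ln (\<sigma> A (weights A k) i)) \<le> ln (real n / real d)"
proof -
  note adm = admissible_weights[OF assms(1)]
  have pos: "0 < weights A k $ i" for k
    using adm i row by (auto simp: admissible_def)
  have "ln (\<sigma> A (weights A k) i) = ln (weights A (Suc k) $ i) - ln (weights A k $ i)" for k
    using \<sigma>_pos[OF adm[of k] i row] pos[of k] A i by (simp add: ln_mult)
  then have "(\<Sum>k<T. ln (\<sigma> A (weights A k) i)) = ln (weights A T $ i) - ln (weights A 0 $ i)"
    using sum_lessThan_telescope[of "\<lambda>k. ln (weights A k $ i)" T] by (simp only:)
  \<comment> \<open>The telescoped sum ends at index \<open>T\<close>, one past the last averaged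
    iterate. As \<open>T\<close> is positive, this weight is the product of weight and \<sigma> at
    \<open>T - 1\<close>.\<close>
  moreover have "weights A T $ i \<le> 1"
    using weight_\<sigma>_le_1[OF adm i, of "T - 1"] assms(2) A i by (cases T) auto
  ultimately show ?thesis
    using pos[of T] A i assms(1) by (simp add: ln_div)
qed

lemma \<sigma>_avg_weights_le:
  assumes "0 < d" "0 < T" and i: "i < n" and "0 < \<epsilon>"
    and T: "ln (real n / real d) \<le> real T * ln (1 + \<epsilon>)"
  shows "\<sigma> A (avg_weights A T) i \<le> 1 + \<epsilon>"
proof (cases "row A i = 0\<^sub>v d")
  case True
  with \<sigma>_zero_row[OF admissible_avg_weights[OF assms(1,2)] i] \<open>0 < \<epsilon>\<close> show ?thesis by simp
next
  case False
  let ?s = "\<lambda>k. \<sigma> A (weights A k) i" and ?t = "\<sigma> A (avg_weights A T) i"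
  have s: "0 < ?s k" for k
    using \<sigma>_pos[OF admissible_weights[OF assms(1)] i False] .
  have t: "0 < ?t"
    using \<sigma>_pos[OF admissible_avg_weights[OF assms(1,2)] i False] .
  \<comment> \<open>AM-GM in tangent form, \<open>ln y \<le> y - 1\<close> at
    \<open>y = (1 + \<epsilon>) / ?s k\<close>. With this scaling the logarithms sum to
    \<open>T * ln (1 + \<epsilon>)\<close> minus the telescoped sum, which is nonnegative by the
    assumption on \<open>T\<close>.\<close>
  have "1 + ln (1 + \<epsilon>) - ln (?s k) \<le> (1 + \<epsilon>) * (1 / ?s k)" for k
    using ln_le_minus_one[of "(1 + \<epsilon>) / ?s k"] s[of k] \<open>0 < \<epsilon>\<close> by (simp add: ln_div)
  then have "(\<Sum>k<T. 1 + ln (1 + \<epsilon>) - ln (?s k)) \<le> (\<Sum>k<T. (1 + \<epsilon>) * (1 / ?s k))"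
    by (intro sum_mono)
  also have "\<dots> = (1 + \<epsilon>) * (\<Sum>k<T. 1 / ?s k)"
    by (simp only: sum_distrib_left)
  finally have "real T \<le> (1 + \<epsilon>) * (\<Sum>k<T. 1 / ?s k)"
    using sum_ln_\<sigma>_weights[OF assms(1,2) i False] T
    by (simp add: sum.distrib sum_subtractf algebra_simps)
  then have "?t * real T \<le> ?t * ((1 + \<epsilon>) * (\<Sum>k<T. 1 / ?s k))"
    using t by simp
  also have "\<dots> = (1 + \<epsilon>) * (?t * (\<Sum>k<T. 1 / ?s k))" by simp
  also have "\<dots> \<le> (1 + \<epsilon>) * real T"
    using \<sigma>_avg_weights_harmonic[OF assms(1,2) i False] \<open>0 < \<epsilon>\<close> by (intro mult_left_mono) auto
  finally show ?thesis using \<open>0 < T\<close> by simp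
qed

end

section \<open>Choice of the number of iterations\<close>

text \<open>The bound \<open>ln y \<le> y - 1\<close> at \<open>y = 1 / (1 + x)\<close> gives
  \<open>x / (1 + x) \<le> ln (1 + x)\<close>, and \<open>1 + x\<close> is at most 2. This makes the
  requirement on \<open>T\<close> linear in \<epsilon>.\<close>

lemma half_le_ln_add_one:
  fixes x :: real
  assumes "0 \<le> x" "x \<le> 1"
  shows "x / 2 \<le> ln (1 + x)"
proof -
  have "ln (1 / (1 + x)) \<le> 1 / (1 + x) - 1"
    using assms by (intro ln_le_minus_one) auto
  then have "x / (1 + x) \<le> ln (1 + x)"
    using assms by (simp add: ln_div field_simps)
  moreover have "x / 2 \<le> x / (1 + x)"
    using assms by (intro divide_left_mono) auto
  ultimately show ?thesis by (rule order.trans[rotated])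
qed

theorem theorem7p2:
  shows "\<exists>C::real. C > 0 \<and>
    (\<forall>(n::nat) (d::nat) (\<epsilon>::real). d \<ge> 1 \<and> 0 < \<epsilon> \<and> \<epsilon> < 1 \<longrightarrow>
      (\<exists>T::nat. T \<ge> 1 \<and> real T \<le> iteration_bound C n d \<epsilon> \<and>
        (\<forall>A. A \<in> carrier_mat n d \<and> vec_space.rank n A = d \<longrightarrow>
          (\<forall>i<n. \<sigma> A (avg_weights A T) i \<le> 1 + \<epsilon>) \<and>
          (\<Sum>i<n. avg_weights A T $ i) = real d)))"
proof (intro exI[of _ "4::real"] conjI allI impI; (elim conjE)?)
  fix n d :: nat and \<epsilon> :: real
  assume d: "1 \<le> d" and \<epsilon>: "0 < \<epsilon>" "\<epsilon> < 1"
  define L where "L = ln (real n / real d)"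
  \<comment> \<open>\<open>T\<close> depends on \<open>n\<close>, \<open>d\<close> and \<epsilon>
    only, so it serves all matrices at once. Rounding down keeps it within the bound;
    \<open>nat\<close> and the maximum give \<open>T = 1\<close> when \<open>L\<close> is not
    positive.\<close>
  define T where "T = max 1 (nat \<lfloor>4 * (1 / \<epsilon>) * L\<rfloor>)"
  have T1: "1 \<le> T" by (simp add: T_def)
  have bound: "real T \<le> iteration_bound 4 n d \<epsilon>"
    unfolding iteration_bound_def T_def L_def[symmetric] by linarith
  \<comment> \<open>The constant 4 rather than 2 pays for the floor: if
    \<open>2 * L / \<epsilon>\<close> exceeds 1, it is at most
    \<open>4 * L / \<epsilon> - 1\<close>; otherwise \<open>T \<ge> 1\<close> suffices.\<close>
  have "2 * ((1 / \<epsilon>) * L) \<le> real T"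
    unfolding T_def by linarith
  then have "L \<le> real T * (\<epsilon> / 2)"
    using \<epsilon> by (simp add: field_simps)
  also have "\<dots> \<le> real T * ln (1 + \<epsilon>)"
    using half_le_ln_add_one[of \<epsilon>] \<epsilon> by (intro mult_left_mono) auto
  finally have L: "L \<le> real T * ln (1 + \<epsilon>)" .
  show "\<exists>T::nat. T \<ge> 1 \<and> real T \<le> iteration_bound 4 n d \<epsilon> \<and>
      (\<forall>A. A \<in> carrier_mat n d \<and> vec_space.rank n A = d \<longrightarrow>
        (\<forall>i<n. \<sigma> A (avg_weights A T) i \<le> 1 + \<epsilon>) \<and>
        (\<Sum>i<n. avg_weights A T $ i) = real d)"
  proof (intro exI[of _ T] conjI allI impI T1 bound; elim conjE)
    fix A :: "real mat"
    assume A: "A \<in> carrier_mat n d" and rank: "vec_space.rank n A = d"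
    interpret full_column_rank A n d
      by unfold_locales (use A vec_space.full_rank_imp_trivial_kernel[OF A rank] in auto)
    show "\<sigma> A (avg_weights A T) i \<le> 1 + \<epsilon>" if "i < n" for i
      using \<sigma>_avg_weights_le[OF _ _ that] d T1 \<epsilon> L unfolding L_def by simp
    show "(\<Sum>i<n. avg_weights A T $ i) = real d"
      using sum_avg_weights d T1 by simp
  qed
qed simp

end
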